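(* For every positive integer $n$, \[\max_{\pi\in S_n}|\operatorname{SC}_{132}^{-1}(\pi)|=\max_{\pi\in S_n}|\operatorname{SC}_{312}^{-1}(\pi)|=\binom{n-1}{\lfloor (n-1)/2\rfloor}.\]
   Context: $S_n$ is the set of permutations of $[n]$ in one-line notation. Two sequences of distinct integers have the same relative order if replacing the $i$th smallest entry of each by $i$ yields the same word; a sequence avoids $\sigma$ consecutively if no consecutive subsequence has the same relative order as $\sigma$. For $\sigma\in\{132,312\}$, $\operatorname{SC}_\sigma:S_n\to S_n$ sends a permutation through a stack: at each step, if there is a next input entry and placing it on top of the stack would make the stack contents, read top to bottom, avoid $\sigma$ consecutively, push it; otherwise pop the top entry of the stack to the end of the output; stop when the output has length $n$. *)

theory Defs
  imports "HOL-Library.Sublist" "HOL-Combinatorics.Multiset_Permutations"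
begin

text \<open>Permutations of \<open>{1..n}\<close> in one-line notation, as lists.\<close>
abbreviation perms :: "nat \<Rightarrow> nat list set" where
  "perms n \<equiv> permutations_of_set {1..n}"

text \<open>On a list of distinct entries, \<open>x\<close> is the \<open>i\<close>th smallest entry iff exactly \<open>i\<close> entries
  are at most \<open>x\<close>.\<close>
definition standardize :: "nat list \<Rightarrow> nat list" where
  "standardize xs = map (\<lambda>x. card {y \<in> set xs. y \<le> x}) xs"

definition same_relative_order :: "nat list \<Rightarrow> nat list \<Rightarrow> bool" where
  "same_relative_order xs ys \<longleftrightarrow> standardize xs = standardize ys"

text \<open>\<^const>\<open>sublist\<close> is the contiguous sublist relation.\<close>
definition avoids_consecutively :: "nat list \<Rightarrow> nat list \<Rightarrow> bool" where
  "avoids_consecutively xs \<sigma> \<longleftrightarrow> \<not> (\<exists>ys. sublist ys xs \<and> same_relative_order ys \<sigma>)"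

text \<open>The arguments of \<open>sc_run \<sigma>\<close> are the remaining input, the stack (top first) and the output so
  far. The output is complete exactly when input and stack are both empty. The branch in which
  the stack is empty and the next entry cannot be pushed is unreachable for patterns of length at
  least 2; it is only there to make the function total.\<close>
fun sc_run :: "nat list \<Rightarrow> nat list \<Rightarrow> nat list \<Rightarrow> nat list \<Rightarrow> nat list" where
  "sc_run \<sigma> [] [] out = out"
| "sc_run \<sigma> [] (s # st) out = sc_run \<sigma> [] st (out @ [s])"
| "sc_run \<sigma> (x # xs) st out =
     (if avoids_consecutively (x # st) \<sigma> then sc_run \<sigma> xs (x # st) out
      else (case st of
              [] \<Rightarrow> out
            | s # st' \<Rightarrow> sc_run \<sigma> (x # xs) st' (out @ [s])))"

definition SC :: "nat list \<Rightarrow> nat list \<Rightarrow> nat list" where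
  "SC \<sigma> \<pi> = sc_run \<sigma> \<pi> [] []"

definition SC_preimage :: "nat list \<Rightarrow> nat \<Rightarrow> nat list \<Rightarrow> nat list set" where
  "SC_preimage \<sigma> n \<pi> = {\<tau> \<in> perms n. SC \<sigma> \<tau> = \<pi>}"

lemma avoids_consecutively_singleton:
  assumes "length \<sigma> \<ge> 2"
  shows "avoids_consecutively [x] \<sigma>"
proof -
  have "\<not> same_relative_order ys \<sigma>" if "sublist ys [x]" for ys
  proof
    assume "same_relative_order ys \<sigma>"
    hence "length ys = length \<sigma>"
      unfolding same_relative_order_def standardize_def by (auto dest: map_eq_imp_length_eq)
    moreover have "length ys \<le> 1"
      using sublist_length_le[OF that] by simp
    ultimately show False using assms by simp
  qed
  thus ?thesis unfolding avoids_consecutively_def by blast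
qed

lemma mset_sc_run:
  assumes "length \<sigma> \<ge> 2"
  shows "mset (sc_run \<sigma> xs st out) = mset xs + mset st + mset out"
  using assms
proof (induction \<sigma> xs st out rule: sc_run.induct)
  case (1 \<sigma> out)
  show ?case by simp
next
  case (2 \<sigma> s st out)
  thus ?case by simp
next
  case (3 \<sigma> x xs st out)
  show ?case
  proof (cases "avoids_consecutively (x # st) \<sigma>")
    case True
    thus ?thesis using "3.IH"(1)[OF True "3.prems"] by simp
  next
    case False
    then obtain s st' where st: "st = s # st'"
      using avoids_consecutively_singleton[OF "3.prems"] by (cases st) auto
    have "mset (sc_run \<sigma> (x # xs) st' (out @ [s])) = mset (x # xs) + mset st' + mset (out @ [s])"
      by (rule "3.IH"(2)[OF False st "3.prems"])
    moreover have "sc_run \<sigma> (x # xs) st out = sc_run \<sigma> (x # xs) st' (out @ [s])"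
      unfolding st using False[unfolded st] by (subst sc_run.simps(3)) (simp del: sc_run.simps)
    ultimately show ?thesis by (simp add: st del: sc_run.simps)
  qed
qed

lemma SC_in_perms:
  assumes "length \<sigma> \<ge> 2" and "\<pi> \<in> perms n"
  shows "SC \<sigma> \<pi> \<in> perms n"
proof -
  have "mset (SC \<sigma> \<pi>) = mset \<pi>"
    unfolding SC_def using mset_sc_run[OF assms(1)] by simp
  hence "set (SC \<sigma> \<pi>) = set \<pi>" "distinct (SC \<sigma> \<pi>) = distinct \<pi>"
    by (auto dest: mset_eq_setD mset_eq_imp_distinct_iff)
  thus ?thesis
    using assms(2) unfolding permutations_of_set_def by simp
qed

end

theory Submission
  imports Defs
begin

text \<open>Complementing the entries exchanges 132 and 312, so only 312 has to be treated. There the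
  top \<open>a\<close> of the stack \<open>a b \<dots>\<close> is popped before the entry \<open>x\<close> iff \<open>a < b < x\<close>. If every such
  pop is recorded by the number of descents below it in the stack, then the output and these
  codes determine the input. The codes increase weakly, and strictly at descents of the output
  \<open>\<pi>\<close>, which bounds the number of preimages by a count depending only on the descents of \<open>\<pi>\<close>.
  If \<open>M\<close> is the last ascent of \<open>\<pi>\<close> and \<open>q\<^sub>1 < \<dots> < q\<^sub>d\<close> are the descents before \<open>M\<close>, this count is
  at most the number of subsets of \<open>{1..n-1}\<close> that either miss \<open>{1..d}\<close> and have \<open>M\<close> elements, or
  meet \<open>{1..d}\<close> with least element \<open>j\<close> and have \<open>q\<^sub>j\<close> elements. They form an antichain, and the
  bound is that of Sperner's theorem.\<close>

section \<open>Consecutive avoidance of patterns of length three\<close>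

lemma standardize_remdups:
  "standardize xs = map (\<lambda>x. length (remdups (filter (\<lambda>y. y \<le> x) xs))) xs"
  unfolding standardize_def by (simp add: length_remdups_card_conv)

lemma same_relative_order_312:
  "same_relative_order [x, a, b] [3, 1, 2] \<longleftrightarrow> a < b \<and> b < x"
  unfolding same_relative_order_def standardize_remdups by auto

lemma same_relative_order_132:
  "same_relative_order [x, a, b] [1, 3, 2] \<longleftrightarrow> x < b \<and> b < a"
  unfolding same_relative_order_def standardize_remdups by auto

lemma same_relative_order_length:
  "same_relative_order xs ys \<Longrightarrow> length xs = length ys"
  unfolding same_relative_order_def standardize_def by (auto dest: map_eq_imp_length_eq)

lemma avoids_consecutively_short:
  assumes "length xs < length \<sigma>"
  shows "avoids_consecutively xs \<sigma>"
  using assms same_relative_order_length sublist_length_le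
  unfolding avoids_consecutively_def by (metis not_le)

text \<open>A factor is a prefix or lies in the tail, and only the prefix of length 3 can match, so
  the new entry and the two below it decide a push.\<close>

lemma avoids_consecutively_Cons3:
  assumes "length \<sigma> = 3"
  shows "avoids_consecutively (x # a # b # l) \<sigma> \<longleftrightarrow>
    avoids_consecutively (a # b # l) \<sigma> \<and> \<not> same_relative_order [x, a, b] \<sigma>"
proof -
  have "(\<exists>ys. prefix ys (x # a # b # l) \<and> same_relative_order ys \<sigma>)
      \<longleftrightarrow> same_relative_order [x, a, b] \<sigma>" (is "?P \<longleftrightarrow> ?Q")
  proof
    assume ?P
    then obtain ys where ys: "prefix ys (x # a # b # l)" "same_relative_order ys \<sigma>" by blast
    have "length ys = 3" using same_relative_order_length[OF ys(2)] assms by simp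
    hence "ys = take 3 (x # a # b # l)"
      using ys(1) by (metis append_eq_conv_conj prefix_def)
    thus ?Q using ys(2) by (simp add: numeral_3_eq_3)
  next
    assume ?Q
    thus ?P by (intro exI[of _ "[x, a, b]"]) simp
  qed
  thus ?thesis unfolding avoids_consecutively_def sublist_Cons_right by blast
qed

section \<open>Complementation of the entries\<close>

lemma avoids_consecutively_complement:
  assumes "set xs \<subseteq> {1..n}"
  shows "avoids_consecutively (map (\<lambda>x. n + 1 - x) xs) [1, 3, 2] \<longleftrightarrow>
    avoids_consecutively xs [3, 1, 2]"
  using assms
proof (induction xs)
  case (Cons x xs)
  show ?case
  proof (cases "length xs < 2")
    case True
    thus ?thesis by (simp add: avoids_consecutively_short)
  next
    case False
    then obtain a b l where xs: "xs = a # b # l"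
      by (cases xs; cases "tl xs") auto
    show ?thesis
      using Cons unfolding xs
      by (auto simp: avoids_consecutively_Cons3 same_relative_order_132 same_relative_order_312
          simp del: One_nat_def)
  qed
qed (simp add: avoids_consecutively_short)

text \<open>Complementation reverses the order, so both runs push and pop at the same steps.\<close>

lemma sc_run_complement:
  assumes "\<sigma> = [3, 1, 2]" "set xs \<subseteq> {1..n}" "set st \<subseteq> {1..n}"
  shows "sc_run [1, 3, 2] (map (\<lambda>x. n + 1 - x) xs) (map (\<lambda>x. n + 1 - x) st)
      (map (\<lambda>x. n + 1 - x) out) = map (\<lambda>x. n + 1 - x) (sc_run \<sigma> xs st out)"
  using assms
proof (induction \<sigma> xs st out rule: sc_run.induct)
  case (3 \<sigma> x xs st out)
  have "set (x # st) \<subseteq> {1..n}" using 3 by simp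
  note av = avoids_consecutively_complement[OF this]
  show ?case
  proof (cases "avoids_consecutively (x # st) \<sigma>")
    case True
    thus ?thesis using 3 av by simp
  next
    case False
    thus ?thesis using 3 av by (cases st) simp_all
  qed
qed auto

lemma SC_complement:
  assumes "\<tau> \<in> perms n"
  shows "SC [1, 3, 2] (map (\<lambda>x. n + 1 - x) \<tau>) = map (\<lambda>x. n + 1 - x) (SC [3, 1, 2] \<tau>)"
  using sc_run_complement[of "[3, 1, 2]" \<tau> n "[]" "[]"] assms
  by (simp add: SC_def permutations_of_set_def)

lemma complement_perms:
  assumes "\<pi> \<in> perms n"
  shows "map (\<lambda>x. n + 1 - x) \<pi> \<in> perms n" "map (\<lambda>x. n + 1 - x) (map (\<lambda>x. n + 1 - x) \<pi>) = \<pi>"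
proof -
  have s: "set \<pi> = {1..n}" "distinct \<pi>" using assms by (auto simp: permutations_of_set_def)
  have "(\<lambda>x. n + 1 - x) ` {1..n} = {1..n}"
  proof
    show "{1..n} \<subseteq> (\<lambda>x. n + 1 - x) ` {1..n}"
      by (rule subsetI, rule_tac x = "n + 1 - x" in image_eqI) auto
  qed auto
  moreover have "inj_on (\<lambda>x. n + 1 - x) {1..n}" by (auto simp: inj_on_def)
  ultimately show "map (\<lambda>x. n + 1 - x) \<pi> \<in> perms n"
    using s by (simp add: permutations_of_set_def distinct_map)
  show "map (\<lambda>x. n + 1 - x) (map (\<lambda>x. n + 1 - x) \<pi>) = \<pi>"
    unfolding map_map by (rule map_idI) (use s in auto)
qed

lemma card_SC_preimage_complement:
  assumes "\<pi> \<in> perms n"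
  shows "card (SC_preimage [1, 3, 2] n (map (\<lambda>x. n + 1 - x) \<pi>)) = card (SC_preimage [3, 1, 2] n \<pi>)"
proof -
  let ?c = "map (\<lambda>x. n + 1 - x)"
  have "bij_betw ?c (SC_preimage [3, 1, 2] n \<pi>) (SC_preimage [1, 3, 2] n (?c \<pi>))"
  proof (rule bij_betw_byWitness[where f' = ?c])
    show "?c ` SC_preimage [3, 1, 2] n \<pi> \<subseteq> SC_preimage [1, 3, 2] n (?c \<pi>)"
      using SC_complement complement_perms(1) by (auto simp: SC_preimage_def simp del: map_map)
    show "?c ` SC_preimage [1, 3, 2] n (?c \<pi>) \<subseteq> SC_preimage [3, 1, 2] n \<pi>"
    proof
      fix \<tau> assume "\<tau> \<in> ?c ` SC_preimage [1, 3, 2] n (?c \<pi>)"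
      then obtain \<rho> where \<rho>: "\<tau> = ?c \<rho>" "\<rho> \<in> perms n" "SC [1, 3, 2] \<rho> = ?c \<pi>"
        by (auto simp: SC_preimage_def)
      have \<tau>: "\<tau> \<in> perms n" "?c \<tau> = \<rho>" using \<rho> complement_perms by metis+
      have "?c (SC [3, 1, 2] \<tau>) = ?c \<pi>" using SC_complement[OF \<tau>(1)] \<tau>(2) \<rho>(3) by simp
      moreover have "SC [3, 1, 2] \<tau> \<in> perms n" using SC_in_perms[OF _ \<tau>(1)] by simp
      ultimately have "SC [3, 1, 2] \<tau> = \<pi>" using complement_perms(2) assms by metis
      thus "\<tau> \<in> SC_preimage [3, 1, 2] n \<pi>" using \<tau>(1) by (simp add: SC_preimage_def)
    qed
  qed (use complement_perms(2) in \<open>auto simp: SC_preimage_def simp del: map_map\<close>)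
  thus ?thesis by (metis bij_betw_same_card)
qed

section \<open>The stack run for 312\<close>

fun descents :: "nat list \<Rightarrow> nat" where
  "descents (x # y # xs) = of_bool (y < x) + descents (y # xs)"
| "descents xs = 0"

text \<open>Pops are put in front of the later output instead of being accumulated. Testing the two
  top entries suffices for a stack that already avoids 312.\<close>

fun run312 :: "nat list \<Rightarrow> nat list \<Rightarrow> nat list" where
  "run312 [] st = st"
| "run312 (x # xs) (a # b # st) =
     (if a < b \<and> b < x then a # run312 (x # xs) (b # st) else run312 xs (x # a # b # st))"
| "run312 (x # xs) st = run312 xs (x # st)"

lemma sc_run_Nil: "sc_run \<sigma> [] st out = out @ st"
  by (induction st arbitrary: out) auto

lemma sc_run_312:
  assumes "avoids_consecutively st [3, 1, 2]"
  shows "sc_run [3, 1, 2] xs st out = out @ run312 xs st"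
  using assms
proof (induction xs st arbitrary: out rule: run312.induct)
  case (1 st)
  show ?case by (simp add: sc_run_Nil)
next
  case (2 x xs a b st)
  have "avoids_consecutively (b # st) [3, 1, 2]"
    using 2(3) by (cases st) (auto simp: avoids_consecutively_short avoids_consecutively_Cons3)
  moreover have "avoids_consecutively (x # a # b # st) [3, 1, 2] \<longleftrightarrow> \<not> (a < b \<and> b < x)"
    using 2(3) by (simp add: avoids_consecutively_Cons3 same_relative_order_312 del: One_nat_def)
  ultimately show ?case
    using 2(1,2) by (cases "a < b \<and> b < x") (auto simp del: One_nat_def)
qed (simp_all add: avoids_consecutively_short del: One_nat_def)

lemma SC_312: "SC [3, 1, 2] \<tau> = run312 \<tau> []"
  unfolding SC_def by (simp add: sc_run_312 avoids_consecutively_short del: One_nat_def)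

lemma set_run312: "set (run312 xs st) = set xs \<union> set st"
  by (induction xs st rule: run312.induct) auto

section \<open>Encoding preimages by the codes of their pops\<close>

text \<open>A pop deletes \<open>a\<close> from a factor \<open>x a b\<close> of the word \<open>rev xs @ st\<close>, where \<open>a < b < x\<close>.
  The pair \<open>x b\<close> left behind is a descent, and the pop is recorded by the number of descents
  to the right of that one.\<close>

fun pop_codes :: "nat list \<Rightarrow> nat list \<Rightarrow> nat list" where
  "pop_codes [] st = []"
| "pop_codes (x # xs) (a # b # st) =
     (if a < b \<and> b < x then descents (b # st) # pop_codes (x # xs) (b # st)
      else pop_codes xs (x # a # b # st))"
| "pop_codes (x # xs) st = pop_codes xs (x # st)"

text \<open>Undoes a pop: \<open>p\<close> goes into the descent with exactly \<open>c\<close>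
  descents to its right, of which there is at most one.\<close>

fun insert_at :: "nat \<Rightarrow> nat \<Rightarrow> nat list \<Rightarrow> nat list" where
  "insert_at c p [] = []"
| "insert_at c p (x # w) =
     (if descents w = c \<and> w \<noteq> [] \<and> hd w < x then x # p # w else x # insert_at c p w)"

text \<open>The last pop is undone first. When no codes are left, no pop remains and the output is
  the word itself.\<close>

fun decode :: "nat list \<Rightarrow> nat list \<Rightarrow> nat list" where
  "decode (c # cs) (p # \<pi>) = insert_at c p (decode cs \<pi>)"
| "decode cs \<pi> = \<pi>"

lemma descents_Cons_ge: "descents w \<le> descents (x # w)"
  by (cases w) auto

lemma descents_append_ge: "descents w \<le> descents (u @ w)"
proof (induction u)
  case (Cons x u)
  thus ?case using descents_Cons_ge[of "u @ w" x] by simp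
qed simp

text \<open>The pair \<open>x b\<close> is a descent, so each longer suffix has more descents than
  \<open>b # st\<close> and the scan does not stop before \<open>x\<close>.\<close>

lemma insert_at_eq:
  assumes "b < x"
  shows "insert_at (descents (b # st)) p (u @ x # b # st) = u @ x # p # b # st"
proof (induction u)
  case (Cons y u)
  have "descents (b # st) < descents (u @ x # b # st)"
    using descents_append_ge[of "x # b # st" u] assms by simp
  thus ?case using Cons by simp
qed (use assms in simp)

lemma decode_pop_codes: "decode (pop_codes xs st) (run312 xs st) = rev xs @ st"
proof (induction xs st rule: pop_codes.induct)
  case (2 x xs a b st)
  show ?case using 2 insert_at_eq[of b x st a "rev xs"] by auto
qed auto

text \<open>A pop replaces the descent \<open>x a\<close> and the ascent \<open>a b\<close> by the
  descent \<open>x b\<close>, which keeps the number of descents; prepending the popped entry cannot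
  lower it.\<close>

lemma descents_run312_ge: "descents (rev xs @ st) \<le> descents (run312 xs st)"
proof (induction xs st rule: run312.induct)
  case (2 x xs a b st)
  show ?case
  proof (cases "a < b \<and> b < x")
    case True
    have "descents (u @ x # a # b # st) = descents (u @ x # b # st)" for u
    proof (induction u)
      case (Cons y u)
      thus ?case by (cases u) auto
    qed (use True in auto)
    thus ?thesis
      using 2(1) True descents_Cons_ge[of "run312 (x # xs) (b # st)" a] by simp
  qed (use 2 in auto)
qed auto

text \<open>The codes of the preimages of \<open>\<pi>\<close>, relaxed to the constraints that can be read off the
  descents of \<open>\<pi>\<close>: they increase weakly, and strictly at the descents of \<open>\<pi>\<close>; and the last
  popped entry does not start a decreasing suffix, since it is smaller than a later one.\<close>

fun code_set :: "nat list \<Rightarrow> nat \<Rightarrow> nat list set" where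
  "code_set [] k = {[]}"
| "code_set (p # \<pi>) k = insert [] (if sorted_wrt (>) (p # \<pi>) then {} else
     \<Union>i\<in>{k..<descents \<pi>}. (#) i ` code_set \<pi> (i + of_bool (hd \<pi> < p)))"

lemma Nil_in_code_set [simp]: "[] \<in> code_set \<pi> k"
  by (cases \<pi>) auto

lemma Cons_in_code_set:
  assumes "\<not> sorted_wrt (>) (p # \<pi>)" "k \<le> i" "i < descents \<pi>"
    and "cs \<in> code_set \<pi> (i + of_bool (hd \<pi> < p))"
  shows "i # cs \<in> code_set (p # \<pi>) k"
  unfolding code_set.simps if_not_P[OF assms(1)]
  using assms(2-4) by (intro insertI2 UN_I[of i] imageI) simp_all

lemma code_set_antimono:
  assumes "k \<le> k'"
  shows "code_set \<pi> k' \<subseteq> code_set \<pi> k"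
proof (cases \<pi>)
  case (Cons p \<rho>)
  let ?f = "\<lambda>i. (#) i ` code_set \<rho> (i + of_bool (hd \<rho> < p))"
  have "(\<Union>i\<in>{k'..<descents \<rho>}. ?f i) \<subseteq> (\<Union>i\<in>{k..<descents \<rho>}. ?f i)"
    using assms by (intro UN_mono) auto
  thus ?thesis
    unfolding Cons code_set.simps by (intro insert_mono) (simp del: sorted_wrt.simps of_bool_eq_iff)
qed simp

text \<open>The second conjunct gives the strict increase at descents. If the incoming entry exceeds
  the top, either the top is output next, or a push adds a descent to the stack and raises the lower
  bound for the later codes.\<close>

lemma pop_codes_in_code_set:
  "pop_codes xs st \<in> code_set (run312 xs st) (descents st) \<and>
   (xs \<noteq> [] \<and> st \<noteq> [] \<and> hd st < hd xs \<longrightarrow> hd (run312 xs st) = hd st \<or>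
      pop_codes xs st \<in> code_set (run312 xs st) (descents st + 1))"
proof (induction xs st rule: pop_codes.induct)
  case (2 x xs a b st)
  show ?case
  proof (cases "a < b \<and> b < x")
    case True
    let ?\<pi> = "run312 (x # xs) (b # st)" and ?i = "descents (b # st)"
    note IH = 2(1)[OF True]
    have "x \<in> set ?\<pi>" by (simp add: set_run312)
    moreover have "a < x" using True by simp
    ultimately have "\<not> sorted_wrt (>) (a # ?\<pi>)" 
      unfolding sorted_wrt.simps using order_less_asym by blast
    \<comment> \<open>The descent \<open>x b\<close> of the current word is not among those of
      \<open>b # st\<close>, and the run does not lower the number of descents.\<close>
    moreover have "?i < descents ?\<pi>"
      using descents_run312_ge[of "x # xs" "b # st"] descents_append_ge[of "x # b # st" "rev xs"]
        True by simp
    \<comment> \<open>If the next output is below \<open>a\<close>, it is not \<open>b\<close>,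
      since \<open>a < b\<close>; then the second conjunct applies.\<close>
    moreover have "pop_codes (x # xs) (b # st) \<in> code_set ?\<pi> (?i + of_bool (hd ?\<pi> < a))"
      using IH True by (cases "hd ?\<pi> < a") auto
    ultimately have "?i # pop_codes (x # xs) (b # st) \<in> code_set (a # ?\<pi>) ?i"
      by (intro Cons_in_code_set order_refl)
    thus ?thesis using True by simp
  next
    case False
    let ?\<pi> = "run312 xs (x # a # b # st)"
    have IH: "pop_codes xs (x # a # b # st) \<in> code_set ?\<pi> (descents (x # a # b # st))"
      using 2(2)[OF False] by blast
    moreover have "descents (a # b # st) \<le> descents (x # a # b # st)"
      by (rule descents_Cons_ge)
    ultimately have "pop_codes xs (x # a # b # st) \<in> code_set ?\<pi> (descents (a # b # st))"
      using code_set_antimono by blast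
    moreover have "descents (x # a # b # st) = descents (a # b # st) + 1" if "a < x"
      using that by simp
    ultimately show ?thesis using False IH
      by (auto simp del: descents.simps)
  qed
next
  case ("3_2" x xs v)
  thus ?case using code_set_antimono[of 0 1] by (cases "v < x") auto
qed auto

section \<open>Counting codes by flags and weights\<close>

text \<open>\<^term>\<open>flags \<pi>\<close> marks the descents among the positions up to the last ascent, and
  \<^term>\<open>weight fl s\<close> counts codes when \<open>s\<close> values are available before reading the first flag.\<close>

fun flags :: "nat list \<Rightarrow> bool list" where
  "flags [] = []"
| "flags (p # \<pi>) = (if sorted_wrt (>) (p # \<pi>) then [] else (hd \<pi> < p) # flags \<pi>)"

fun weight :: "bool list \<Rightarrow> nat \<Rightarrow> nat" where
  "weight [] s = 1"
| "weight (False # fl) s = 1 + (\<Sum>i = 1..s. weight fl i)"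
| "weight (True # fl) s = 1 + (\<Sum>i < s - 1. weight fl i)"

lemma descents_Cons: "\<pi> \<noteq> [] \<Longrightarrow> descents (p # \<pi>) = of_bool (hd \<pi> < p) + descents \<pi>"
  by (cases \<pi>) auto

lemma finite_code_set: "finite (code_set \<pi> k)"
  by (induction \<pi> k rule: code_set.induct) auto

lemma card_code_set_le: "card (code_set \<pi> k) \<le> weight (flags \<pi>) (descents \<pi> - k)"
proof (induction \<pi> arbitrary: k)
  case (Cons p \<pi>)
  show ?case
  proof (cases "sorted_wrt (>) (p # \<pi>)")
    case True
    thus ?thesis by (simp del: sorted_wrt.simps)
  next
    case False
    hence ne: "\<pi> \<noteq> []" by auto
    let ?D = "descents \<pi>" and ?\<delta> = "of_bool (hd \<pi> < p) :: nat"
    have "card (code_set (p # \<pi>) k)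
        \<le> 1 + card (\<Union>i\<in>{k..<?D}. (#) i ` code_set \<pi> (i + ?\<delta>))"
      using False by (simp add: card_insert_if finite_code_set del: sorted_wrt.simps)
    also have "\<dots> \<le> 1 + (\<Sum>i\<in>{k..<?D}. card ((#) i ` code_set \<pi> (i + ?\<delta>)))"
      by (intro add_left_mono card_UN_le) simp
    also have "\<dots> = 1 + (\<Sum>i\<in>{k..<?D}. card (code_set \<pi> (i + ?\<delta>)))"
      by (simp add: card_image)
    also have "\<dots> \<le> 1 + (\<Sum>i\<in>{k..<?D}. weight (flags \<pi>) (?D - (i + ?\<delta>)))"
      by (intro add_left_mono sum_mono Cons.IH)
    also have "\<dots> = weight (flags (p # \<pi>)) (descents (p # \<pi>) - k)"
    proof (cases "hd \<pi> < p")
      case True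
      \<comment> \<open>The descent at \<open>p\<close> makes \<open>?D - k\<close> equal to
        \<open>s - 1\<close> for \<open>s = descents (p # \<pi>) - k\<close>, and strict increase
        leaves \<open>?D - (i + 1)\<close> values after the code \<open>i\<close>.\<close>
      have "(\<Sum>i\<in>{k..<?D}. weight (flags \<pi>) (?D - (i + 1))) = (\<Sum>i<?D - k. weight (flags \<pi>) i)"
        by (rule sum.reindex_bij_witness[of _ "\<lambda>i. ?D - (i + 1)" "\<lambda>i. ?D - (i + 1)"]) auto
      thus ?thesis using True False ne by (simp add: descents_Cons del: sorted_wrt.simps)
    next
      case nd: False
      have "(\<Sum>i\<in>{k..<?D}. weight (flags \<pi>) (?D - i)) = (\<Sum>i=1..?D - k. weight (flags \<pi>) i)"
        by (rule sum.reindex_bij_witness[of _ "\<lambda>i. ?D - i" "\<lambda>i. ?D - i"]) auto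
      thus ?thesis using nd False ne by (simp add: descents_Cons del: sorted_wrt.simps)
    qed
    finally show ?thesis .
  qed
qed simp

lemma weight_0 [simp]: "weight fl 0 = 1"
  by (cases "(fl, 0 :: nat)" rule: weight.cases) auto

lemma weight_False_Suc: "weight (False # fl) (Suc s) = weight (False # fl) s + weight fl (Suc s)"
  by simp

text \<open>The summand for \<open>i = 0\<close> is 1, and with it the sum becomes the weight for a
  flag \<open>False\<close>: a leading descent is traded for an ascent at the price of two
  values.\<close>

lemma weight_True:
  "weight (True # fl) s = 1 + (if s \<ge> 2 then weight (False # fl) (s - 2) else 0)"
proof (cases "s \<ge> 2")
  case True
  then obtain t where s: "s = t + 2" by (metis add.commute le_Suc_ex)
  have "(\<Sum>i<Suc t. weight fl i) = 1 + (\<Sum>i = 1..t. weight fl i)"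
    by (induction t) auto
  thus ?thesis by (simp add: s)
qed auto

section \<open>Binomial bounds for the weights\<close>

lemma weight_replicate_False: "weight (replicate a False) s = (s + a) choose a"
proof (induction a arbitrary: s)
  case (Suc a)
  note IH = Suc
  show ?case
  proof (induction s)
    case (Suc s)
    thus ?case using IH[of "Suc s"] weight_False_Suc[of "replicate a False" s]
      by (simp del: weight.simps)
  qed simp
qed simp

text \<open>\<open>weight_True\<close> is the case \<open>a = 0\<close>; each further leading
  \<open>False\<close> sums both sides over \<open>s\<close> by the same recurrence.\<close>

lemma weight_replicate_False_True:
  "weight (replicate a False @ True # fl) s =
    ((s + a) choose a) + (if s \<ge> 2 then weight (replicate (Suc a) False @ fl) (s - 2) else 0)"
proof (induction a arbitrary: s)
  case 0
  show ?case by (simp add: weight_True del: weight.simps)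
next
  case (Suc a)
  note IH = Suc
  show ?case
  proof (induction s)
    case (Suc s)
    let ?g = "replicate a False @ True # fl" and ?h = "replicate (Suc a) False @ fl"
    \<comment> \<open>The second summand is absent up to \<open>s = 1\<close>, starts with the value
      1 at 2, and then follows its own recurrence.\<close>
    consider "s = 0" | "s = 1" | t where "s = t + 2"
      using le_Suc_ex[of 2 s] by (force simp: add.commute)
    thus ?case
    proof cases
      case (3 t)
      thus ?thesis using IH[of "Suc s"] Suc weight_False_Suc[of ?g s] weight_False_Suc[of ?h t]
        by (simp del: weight.simps)
    qed (use IH[of "Suc s"] Suc weight_False_Suc[of ?g s] in \<open>simp_all del: weight.simps\<close>)
  qed simp
qed

text \<open>As in the LYM inequality, the two summands are the fractions \<open>(q + 1) / (N + 1)\<close> and \<open>(N + 1 - b) / (N + 1)\<close>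
  of the right-hand binomial coefficients, and these fractions add up to at most 1.\<close>

lemma binomial_add_le_max:
  assumes "q < b"
  shows "(N choose q) + (N choose b) \<le> max (Suc N choose Suc q) (Suc N choose b)"
proof (cases "b \<le> Suc N")
  case True
  let ?m = "max (Suc N choose Suc q) (Suc N choose b)"
  have "Suc N * ((N choose q) + (N choose b))
      = Suc q * (Suc N choose Suc q) + (Suc N - b) * (Suc N choose b)"
    using binomial_absorption[of q "Suc N"] binomial_absorb_comp[of "Suc N" b]
    by (simp only: diff_Suc_1 add_mult_distrib2)
  also have "\<dots> \<le> Suc q * ?m + (Suc N - b) * ?m"
    by (intro add_mono mult_left_mono) auto
  also have "\<dots> = (Suc q + (Suc N - b)) * ?m" by (simp only: add_mult_distrib)
  also have "\<dots> \<le> Suc N * ?m" using assms True by (intro mult_right_mono) auto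
  finally show ?thesis using Suc_mult_le_cancel1 by blast
next
  case False
  thus ?thesis by (simp add: binomial_eq_0)
qed

text \<open>Each leading \<open>False\<close> is absorbed into \<open>a\<close>. At a
  \<open>True\<close> the weight splits into two parts, bounded by binomial coefficients that
  \<open>binomial_add_le_max\<close> merges; the lower bound on \<open>b\<close> keeps their lower
  indices apart.\<close>

lemma weight_le_binomial:
  assumes "fl \<noteq> [] \<Longrightarrow> \<not> last fl"
  shows "\<exists>b \<ge> a + of_bool (fl \<noteq> []). weight (replicate a False @ fl) s
    \<le> (a + length (filter Not fl) + s) choose b"
  using assms
proof (induction fl arbitrary: a s)
  case Nil
  show ?case by (intro exI[of _ a]) (simp add: weight_replicate_False add.commute)
next
  case (Cons \<delta> fl)
  have last: "fl \<noteq> [] \<Longrightarrow> \<not> last fl" using Cons.prems by auto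
  show ?case
  proof (cases \<delta>)
    case False
    obtain b where "b \<ge> Suc a" "weight (replicate (Suc a) False @ fl) s
        \<le> (Suc a + length (filter Not fl) + s) choose b"
      using Cons.IH[OF last, of "Suc a" s] by (meson add_leD1)
    thus ?thesis using False
      by (intro exI[of _ b]) (simp add: replicate_app_Cons_same del: weight.simps)
  next
    case True
    hence ne: "fl \<noteq> []" using Cons.prems by auto
    hence "\<not> last fl" "last fl \<in> set fl" using last last_in_set by blast+
    hence "filter Not fl \<noteq> []" by (metis filter_empty_conv)
    then obtain z where z: "length (filter Not fl) = Suc z" by (cases "filter Not fl") auto
    let ?N = "a + z + s"
    have le: "(s + a) choose a \<le> ?N choose a"
      by (intro binomial_right_mono) simp
    have "\<exists>b \<ge> Suc a. weight (replicate a False @ True # fl) s \<le> (Suc ?N) choose b"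
    proof (cases "s \<ge> 2")
      case s2: True
      obtain b where b: "b \<ge> Suc (Suc a)" "weight (replicate (Suc a) False @ fl) (s - 2)
          \<le> (Suc a + length (filter Not fl) + (s - 2)) choose b"
        using Cons.IH[OF last, of "Suc a" "s - 2"] ne by auto
      \<comment> \<open>One more leading \<open>False\<close> and two values fewer lower the total
        from \<open>Suc ?N\<close> to \<open>?N\<close>.\<close>
      have "Suc a + length (filter Not fl) + (s - 2) = ?N" using s2 z by simp
      hence "weight (replicate a False @ True # fl) s \<le> (?N choose a) + (?N choose b)"
        using weight_replicate_False_True[of a fl s] le b(2) s2 by (simp del: weight.simps)
      also have "\<dots> \<le> max (Suc ?N choose Suc a) (Suc ?N choose b)"
        using b(1) by (intro binomial_add_le_max) simp
      finally show ?thesis using b(1) by (metis Suc_leD le_refl max_def)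
    next
      case False
      hence "weight (replicate a False @ True # fl) s \<le> (?N choose a)"
        using weight_replicate_False_True[of a fl s] le by (simp del: weight.simps)
      also have "\<dots> \<le> Suc ?N choose Suc a" by simp
      finally show ?thesis by blast
    qed
    thus ?thesis using True z by (simp del: weight.simps binomial_Suc_Suc)
  qed
qed

text \<open>The flags stop where the strictly decreasing suffix begins, so the last one marks a
  nondescent.\<close>

lemma flags_last: "flags \<pi> \<noteq> [] \<Longrightarrow> \<not> last (flags \<pi>)"
proof (induction \<pi>)
  case (Cons p \<pi>)
  have ns: "\<not> sorted_wrt (>) (p # \<pi>)" using Cons.prems by (auto split: if_splits)
  show ?case
  proof (cases "flags \<pi> = []")
    case True
    then obtain q \<rho> where \<pi>: "\<pi> = q # \<rho>" "sorted_wrt (>) \<pi>"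
      using ns by (cases \<pi>) (auto split: if_splits)
    hence "\<not> q < p" using ns by auto
    thus ?thesis using ns True \<pi>(1) by simp
  next
    case False
    thus ?thesis using Cons.IH ns by (simp del: sorted_wrt.simps)
  qed
qed simp

lemma descents_sorted: "sorted_wrt (>) \<pi> \<Longrightarrow> descents \<pi> = length \<pi> - 1"
  by (induction \<pi> rule: descents.induct) auto

text \<open>Among the adjacent pairs, every nondescent starts before the decreasing suffix and so
  carries a flag.\<close>

lemma length_flags:
  "\<pi> \<noteq> [] \<Longrightarrow> length (filter Not (flags \<pi>)) + descents \<pi> = length \<pi> - 1"
proof (induction \<pi>)
  case (Cons p \<pi>)
  show ?case
  proof (cases "sorted_wrt (>) (p # \<pi>)")
    case True
    thus ?thesis using descents_sorted[OF True] by (simp del: sorted_wrt.simps)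
  next
    case False
    hence ne: "\<pi> \<noteq> []" by auto
    hence "length \<pi> > 0" by simp
    thus ?thesis
      using Cons.IH[OF ne] False by (simp add: descents_Cons[OF ne] del: sorted_wrt.simps)
  qed
qed simp

section \<open>The upper bound\<close>

lemma finite_SC_preimage: "finite (SC_preimage \<sigma> n \<pi>)"
  unfolding SC_preimage_def by simp

lemma card_SC_preimage_312_le:
  assumes "n \<ge> 1" "\<pi> \<in> perms n"
  shows "card (SC_preimage [3, 1, 2] n \<pi>) \<le> (n - 1) choose ((n - 1) div 2)"
proof -
  have len: "length \<pi> = n" using assms(2) by (simp add: length_finite_permutations_of_set)
  hence ne: "\<pi> \<noteq> []" using assms(1) by auto
  let ?f = "\<lambda>\<tau>. pop_codes \<tau> []"
  have "inj_on ?f (SC_preimage [3, 1, 2] n \<pi>)"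
  proof (rule inj_onI)
    fix \<tau> \<tau>' assume "\<tau> \<in> SC_preimage [3, 1, 2] n \<pi>" "\<tau>' \<in> SC_preimage [3, 1, 2] n \<pi>"
      and "?f \<tau> = ?f \<tau>'"
    hence "rev \<tau> = rev \<tau>'"
      using decode_pop_codes[of \<tau> "[]"] decode_pop_codes[of \<tau>' "[]"]
      by (simp add: SC_preimage_def SC_312 del: One_nat_def)
    thus "\<tau> = \<tau>'" by simp
  qed
  moreover have "?f ` SC_preimage [3, 1, 2] n \<pi> \<subseteq> code_set \<pi> 0"
    using pop_codes_in_code_set[of _ "[]"] by (auto simp: SC_preimage_def SC_312 simp del: One_nat_def)
  ultimately have "card (SC_preimage [3, 1, 2] n \<pi>) \<le> card (code_set \<pi> 0)"
    using finite_code_set by (metis card_inj_on_le)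
  also have "\<dots> \<le> weight (flags \<pi>) (descents \<pi>)"
    using card_code_set_le[of \<pi> 0] by simp
  also obtain b where "weight (flags \<pi>) (descents \<pi>)
      \<le> (length (filter Not (flags \<pi>)) + descents \<pi>) choose b"
    using weight_le_binomial[of "flags \<pi>" 0 "descents \<pi>"] flags_last by auto
  also have "length (filter Not (flags \<pi>)) + descents \<pi> = n - 1"
    using length_flags[OF ne] len by simp
  also have "(n - 1) choose b \<le> (n - 1) choose ((n - 1) div 2)"
    by (rule binomial_maximum)
  finally show ?thesis .
qed

section \<open>An output attaining the bound\<close>

text \<open>The extremal output is \<open>1 \<dots> L n \<dots> L+1\<close> with \<open>L = (n - 1) div 2\<close>. In its preimages the
  entries above \<open>L\<close> increase, and the entries up to \<open>L\<close> are cut into consecutive intervals, one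
  of which is placed in decreasing order behind each of the large entries.\<close>

fun fillings :: "nat \<Rightarrow> nat \<Rightarrow> nat \<Rightarrow> nat \<Rightarrow> nat list set" where
  "fillings p j h 0 = {rev [p..<p + j]}"
| "fillings p j h (Suc k) =
     (\<Union>a\<le>j. (\<lambda>xs. rev [p..<p + a] @ h # xs) ` fillings (p + a) (j - a) (Suc h) k)"

lemma run312_push: "x \<le> c \<Longrightarrow> run312 (x # xs) (c # st) = run312 xs (x # c # st)"
  by (cases st) auto

lemma run312_push_decreasing:
  assumes "p + a \<le> c"
  shows "run312 (rev [p..<p + a] @ ys) (c # st) = run312 ys ([p..<p + a] @ c # st)"
  using assms
proof (induction a arbitrary: c st)
  case (Suc a)
  thus ?case using Suc.IH[of "p + a" "c # st"] by (simp add: run312_push)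
qed simp

lemma run312_pop_increasing:
  assumes "sorted_wrt (<) (us @ [c])" "c < h"
  shows "run312 (h # ys) (us @ c # st) = us @ run312 (h # ys) (c # st)"
  using assms
proof (induction us)
  case (Cons u us)
  thus ?case by (cases us) auto
qed simp

text \<open>Here \<open>c\<close> is the last large entry pushed and \<open>h\<close> the next one.
  The interval before \<open>h\<close> lies increasing on top of \<open>c\<close>, so
  \<open>h\<close> pops exactly this interval; \<open>c\<close> stays, as no larger entry lies
  directly below it.\<close>

lemma run312_fillings:
  assumes "xs \<in> fillings p j h k" "p + j \<le> c" "c < h" "st = [] \<or> hd st < c"
  shows "run312 xs (c # st) = [p..<p + j] @ rev [h..<h + k] @ c # st"
  using assms
proof (induction k arbitrary: xs p j h c st)
  case 0
  thus ?case using run312_push_decreasing[of p j c "[]" st] by simp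
next
  case (Suc k)
  then obtain a ys where a: "a \<le> j" "xs = rev [p..<p + a] @ h # ys"
    "ys \<in> fillings (p + a) (j - a) (Suc h) k" by auto
  have "sorted_wrt (<) ([p..<p + a] @ [c])"
    using a(1) Suc.prems(2) by (auto simp: sorted_wrt_append)
  hence "run312 xs (c # st) = [p..<p + a] @ run312 (h # ys) (c # st)"
    using a Suc.prems(2,3) run312_push_decreasing[of p a c "h # ys" st]
    by (simp add: run312_pop_increasing)
  also have "run312 (h # ys) (c # st) = run312 ys (h # c # st)"
    using Suc.prems(4) by (cases st) auto
  also have "\<dots> = [p + a..<p + j] @ rev [Suc h..<Suc h + k] @ h # c # st"
    using Suc.IH[OF a(3), of h "c # st"] a(1) Suc.prems(2,3) by simp
  also have "[p..<p + a] @ [p + a..<p + j] @ rev [Suc h..<Suc h + k] @ h # c # st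
      = [p..<p + j] @ rev [h..<h + Suc k] @ c # st"
    using upt_add_eq_append[of p "p + a" "j - a"] upt_conv_Cons[of h "h + Suc k"] a(1)
    by (simp del: upt_Suc)
  finally show ?case .
qed

lemma finite_fillings: "finite (fillings p j h k)"
  by (induction k arbitrary: p j h) auto

lemma card_fillings:
  assumes "p + j \<le> h"
  shows "card (fillings p j h k) = (j + k) choose k"
  using assms
proof (induction k arbitrary: p j h)
  case (Suc k)
  let ?F = "\<lambda>a. (\<lambda>xs. rev [p..<p + a] @ h # xs) ` fillings (p + a) (j - a) (Suc h) k"
  \<comment> \<open>The number of entries before \<open>h\<close> recovers \<open>a\<close>, so the
    union is disjoint.\<close>
  have len: "length (takeWhile (\<lambda>x. x < h) xs) = a" if a: "a \<le> j" "xs \<in> ?F a" for a xs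
  proof -
    obtain ys where "xs = rev [p..<p + a] @ h # ys" using a(2) by blast
    moreover have "takeWhile (\<lambda>x. x < h) (rev [p..<p + a] @ h # ys) = rev [p..<p + a]"
      using a(1) Suc.prems by (subst takeWhile_append2) auto
    ultimately show ?thesis by simp
  qed
  have "card (fillings p j h (Suc k)) = (\<Sum>a\<le>j. card (?F a))"
    unfolding fillings.simps
  proof (rule card_UN_disjoint)
    show "\<forall>a\<in>{..j}. \<forall>b\<in>{..j}. a \<noteq> b \<longrightarrow> ?F a \<inter> ?F b = {}"
      using len by (metis atMost_iff disjoint_iff)
  qed (auto simp: finite_fillings)
  also have "\<dots> = (\<Sum>a\<le>j. (j - a + k) choose k)"
  proof (rule sum.cong[OF refl])
    fix a assume "a \<in> {..j}"
    thus "card (?F a) = (j - a + k) choose k"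
      using Suc.IH[of "p + a" "j - a" "Suc h"] Suc.prems by (simp add: card_image inj_on_def)
  qed
  also have "\<dots> = (\<Sum>i\<le>j. (k + i) choose k)"
    by (rule sum.reindex_bij_witness[of _ "\<lambda>i. j - i" "\<lambda>i. j - i"]) (auto simp: add.commute)
  also have "\<dots> = (j + Suc k) choose Suc k"
    using choose_rising_sum(1)[of k j] by (simp add: add.commute)
  finally show ?case .
qed simp

lemma card_SC_preimage_312_ge:
  assumes "L < n"
  obtains \<pi> where "\<pi> \<in> perms n" "((n - 1) choose L) \<le> card (SC_preimage [3, 1, 2] n \<pi>)"
proof
  \<comment> \<open>The entry \<open>Suc L\<close> comes first and stays at the bottom, which leaves
    \<open>?k\<close> large entries.\<close>
  let ?k = "n - 1 - L"
  let ?\<pi> = "[1..<Suc L] @ rev [Suc L..<Suc n]"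
  let ?X = "(#) (Suc L) ` fillings 1 L (Suc (Suc L)) ?k"
  have "set ?\<pi> = {1..n}" "distinct ?\<pi>" using assms by auto
  thus \<pi>: "?\<pi> \<in> perms n" by (simp add: permutations_of_set_def del: upt_Suc)
  have "?X \<subseteq> SC_preimage [3, 1, 2] n ?\<pi>"
  proof
    fix \<tau> assume "\<tau> \<in> ?X"
    then obtain xs where xs: "\<tau> = Suc L # xs" "xs \<in> fillings 1 L (Suc (Suc L)) ?k" by auto
    have "SC [3, 1, 2] \<tau> = [1..<Suc L] @ rev [Suc (Suc L)..<Suc (Suc L) + ?k] @ [Suc L]"
      using run312_fillings[OF xs(2), of "Suc L" "[]"] xs(1) by (simp add: SC_312[unfolded One_nat_def] del: upt_Suc)
    also have "\<dots> = ?\<pi>"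
      using assms upt_conv_Cons[of "Suc L" "Suc n"] by (simp del: upt_Suc)
    finally have SC: "SC [3, 1, 2] \<tau> = ?\<pi>" .
    \<comment> \<open>The run preserves the multiset of entries, so \<open>\<tau>\<close> is a
      permutation because its output is one.\<close>
    hence "mset \<tau> = mset ?\<pi>"
      using mset_sc_run[of "[3, 1, 2]" \<tau> "[]" "[]"] by (simp add: SC_def del: upt_Suc)
    hence "\<tau> \<in> perms n"
      using \<pi> mset_eq_setD mset_eq_imp_distinct_iff unfolding permutations_of_set_def by blast
    thus "\<tau> \<in> SC_preimage [3, 1, 2] n ?\<pi>" using SC by (simp add: SC_preimage_def)
  qed
  hence "card ?X \<le> card (SC_preimage [3, 1, 2] n ?\<pi>)"
    by (intro card_mono finite_SC_preimage)
  moreover have "card ?X = (n - 1) choose ?k"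
    using card_fillings[of 1 L "Suc (Suc L)" ?k] assms by (simp add: card_image)
  moreover have "(n - 1) choose ?k = (n - 1) choose L"
    using assms binomial_symmetric[of L "n - 1"] by simp
  ultimately show "((n - 1) choose L) \<le> card (SC_preimage [3, 1, 2] n ?\<pi>)" by simp
qed

section \<open>The two maxima\<close>

theorem theorem4p11:
  fixes n :: nat
  assumes "n \<ge> 1"
  shows "Max ((\<lambda>\<pi>. card (SC_preimage [1,3,2] n \<pi>)) ` perms n)
           = Max ((\<lambda>\<pi>. card (SC_preimage [3,1,2] n \<pi>)) ` perms n)
       \<and> Max ((\<lambda>\<pi>. card (SC_preimage [3,1,2] n \<pi>)) ` perms n)
           = (n - 1) choose ((n - 1) div 2)"
proof
  let ?f = "\<lambda>\<sigma> \<pi>. card (SC_preimage \<sigma> n \<pi>)" and ?c = "map (\<lambda>x. n + 1 - x)"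
  have "?c ` perms n = perms n"
  proof
    show "?c ` perms n \<subseteq> perms n" using complement_perms(1) by blast
    show "perms n \<subseteq> ?c ` perms n"
      by (rule subsetI, rule image_eqI, rule complement_perms(2)[symmetric])
        (auto intro: complement_perms(1) simp del: map_map One_nat_def)
  qed
  hence "?f [1, 3, 2] ` perms n = (?f [1, 3, 2] \<circ> ?c) ` perms n"
    by (simp only: image_comp[symmetric])
  also have "\<dots> = ?f [3, 1, 2] ` perms n"
    by (intro image_cong refl) (simp only: comp_apply card_SC_preimage_complement)
  finally show "Max (?f [1, 3, 2] ` perms n) = Max (?f [3, 1, 2] ` perms n)" by simp
  obtain \<pi> where \<pi>: "\<pi> \<in> perms n" "((n - 1) choose ((n - 1) div 2)) \<le> ?f [3, 1, 2] \<pi>"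
    by (rule card_SC_preimage_312_ge[of "(n - 1) div 2" n]) (use assms in auto)
  show "Max (?f [3, 1, 2] ` perms n) = (n - 1) choose ((n - 1) div 2)"
  proof (rule Max_eqI)
    show "(n - 1) choose ((n - 1) div 2) \<in> ?f [3, 1, 2] ` perms n"
      using \<pi> card_SC_preimage_312_le[OF assms \<pi>(1)] by (metis image_eqI le_antisym)
  qed (use card_SC_preimage_312_le[OF assms] in auto)
qed

end
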